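(* Let $K\subset\mathbb{R}^{m\times n}$ be a proper cone and $\Omega$ be a convex subset in a Banach space $W$. Let $F,G:\Omega\to\mathbb{R}^{m\times n}$ be Fréchet-differentiable strictly $K$-convex functions. Then the generalized Bregman divergence $D_F$ associated with the function $F$ exhibits the following properties: 1. $D_F(x,y)\succeq_K \mathbf{0}$. 2. $D_{c_1F+c_2G}(x,y)=c_1D_F(x,y)+c_2D_G(x,y)$ for constants $c_1,c_2>0$. 3. $D_F(\cdot,y)$ is $K$-convex for any $y\in\Omega$.
   Context: A proper cone $K\subset\mathbb{R}^{m\times n}$ is a cone that is convex, closed, with non-empty interior and pointed. It defines a partial ordering on $\mathbb{R}^{m\times n}$ by $x\preceq_K y\iff y-x\in K$ and $x\prec_K y\iff y-x\in\mathrm{int}(K)$, where $\mathrm{int}(\cdot)$ denotes the interior of the set; $x\succeq_K y$ and $x\succ_K y$ mean $y\preceq_K x$ and $y\prec_K x$, respectively. A function $F:\Omega\to\mathbb{R}^{m\times n}$ on a convex set $\Omega$ is $K$-convex if and only if $F(\theta x+(1-\theta)y)\preceq_K\theta F(x)+(1-\theta)F(y)$ for $x,y\in\Omega$ and $\theta\in[0,1]$, and strictly $K$-convex if and only if $F(\theta x+(1-\theta)y)\prec_K\theta F(x)+(1-\theta)F(y)$ for $x\neq y$ in $\Omega$ and $\theta\in(0,1)$. Fréchet derivative: let $V$ and $Z$ be Banach spaces with norms $\|\cdot\|_V$ and $\|\cdot\|_Z$, and let $U\subset V$ be open. A function $F:U\to Z$ is called Fréchet differentiable at $x\in U$ if there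 exists a bounded linear operator $DF(x)(\cdot):V\to Z$ such that $$\lim_{\|h\|_V\to0}\frac{\|F(x+h)-F(x)-DF(x)(h)\|_Z}{\|h\|_V}=0;$$ $DF(x)$ is called the Fréchet derivative of $F$ at $x$. Generalized Bregman divergence: for a proper cone $K\subset\mathbb{R}^{m\times n}$, a convex subset $\Omega$ in a Banach space $W$, and a Fréchet-differentiable strictly $K$-convex function $F:\Omega\to\mathbb{R}^{m\times n}$, the generalized Bregman divergence between $x,y\in\Omega$ is $$D_F(x,y):=F(x)-F(y)-DF(y)(x-y),$$ where $DF(y)(\cdot)$ is the Fréchet derivative of $F$ at $y$. *)

theory Defs
  imports "HOL-Analysis.Analysis"
begin

definition proper_cone :: "'z::real_normed_vector set \<Rightarrow> bool" where
  "proper_cone K \<longleftrightarrow>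
     cone K \<and> convex K \<and> closed K \<and> interior K \<noteq> {} \<and> (\<forall>x. x \<in> K \<and> - x \<in> K \<longrightarrow> x = 0)"

definition cone_le :: "'z::real_normed_vector \<Rightarrow> 'z set \<Rightarrow> 'z \<Rightarrow> bool"
    ("(_ \<preceq>\<^bsub>_\<^esub> _)" [51, 0, 51] 50) where
  "x \<preceq>\<^bsub>K\<^esub> y \<longleftrightarrow> y - x \<in> K"

definition cone_less :: "'z::real_normed_vector \<Rightarrow> 'z set \<Rightarrow> 'z \<Rightarrow> bool"
    ("(_ \<prec>\<^bsub>_\<^esub> _)" [51, 0, 51] 50) where
  "x \<prec>\<^bsub>K\<^esub> y \<longleftrightarrow> y - x \<in> interior K"

abbreviation cone_ge :: "'z::real_normed_vector \<Rightarrow> 'z set \<Rightarrow> 'z \<Rightarrow> bool"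
    ("(_ \<succeq>\<^bsub>_\<^esub> _)" [51, 0, 51] 50) where
  "x \<succeq>\<^bsub>K\<^esub> y \<equiv> y \<preceq>\<^bsub>K\<^esub> x"

definition cone_convex_on ::
  "'z::real_normed_vector set \<Rightarrow> 'w::real_vector set \<Rightarrow> ('w \<Rightarrow> 'z) \<Rightarrow> bool" where
  "cone_convex_on K \<Omega> F \<longleftrightarrow> convex \<Omega> \<and>
     (\<forall>x\<in>\<Omega>. \<forall>y\<in>\<Omega>. \<forall>\<theta>\<in>{0..1}.
        F (\<theta> *\<^sub>R x + (1 - \<theta>) *\<^sub>R y) \<preceq>\<^bsub>K\<^esub> \<theta> *\<^sub>R F x + (1 - \<theta>) *\<^sub>R F y)"

definition strictly_cone_convex_on ::
  "'z::real_normed_vector set \<Rightarrow> 'w::real_vector set \<Rightarrow> ('w \<Rightarrow> 'z) \<Rightarrow> bool" where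
  "strictly_cone_convex_on K \<Omega> F \<longleftrightarrow> convex \<Omega> \<and>
     (\<forall>x\<in>\<Omega>. \<forall>y\<in>\<Omega>. \<forall>\<theta>\<in>{0<..<1}. x \<noteq> y \<longrightarrow>
        F (\<theta> *\<^sub>R x + (1 - \<theta>) *\<^sub>R y) \<prec>\<^bsub>K\<^esub> \<theta> *\<^sub>R F x + (1 - \<theta>) *\<^sub>R F y)"

text \<open>
  The derivative is taken within \<open>\<Omega>\<close>, which is not assumed to be open. For open \<open>\<Omega>\<close>, or for
  \<open>F\<close> differentiable on a neighbourhood of \<open>\<Omega>\<close>, this is the usual Frechet derivative; see
  \<open>bregman_eq_at\<close>. In general the derivative within \<open>\<Omega>\<close> need not be unique, but on a convex
  \<open>\<Omega>\<close> its value at \<open>x - y\<close> is, so the divergence is independent of the choice made by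
  \<^const>\<open>frechet_derivative\<close>; see \<open>bregman_eq\<close>.
\<close>

definition bregman ::
  "'w::real_normed_vector set \<Rightarrow> ('w \<Rightarrow> 'z::real_normed_vector) \<Rightarrow> 'w \<Rightarrow> 'w \<Rightarrow> 'z" where
  "bregman \<Omega> F x y = F x - F y - frechet_derivative F (at y within \<Omega>) (x - y)"

lemma has_derivative_within_convex_unique:
  assumes "convex \<Omega>" "x \<in> \<Omega>" "y \<in> \<Omega>"
    and "(F has_derivative A) (at y within \<Omega>)" "(F has_derivative B) (at y within \<Omega>)"
  shows "A (x - y) = B (x - y)"
proof -
  define g where "g t = y + t *\<^sub>R (x - y)" for t :: real
  have sub: "g ` {0..1} \<subseteq> \<Omega>"
  proof clarify
    fix t :: real assume "t \<in> {0..1}"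
    moreover have "g t = (1 - t) *\<^sub>R y + t *\<^sub>R x"
      by (simp add: g_def algebra_simps)
    ultimately show "g t \<in> \<Omega>"
      using assms(1-3) by (simp add: convexD)
  qed
  have g: "(g has_derivative (\<lambda>t. t *\<^sub>R (x - y))) (at 0 within {0..1})"
    unfolding g_def by (auto intro!: derivative_eq_intros)
  have vec: "((\<lambda>t. F (g t)) has_vector_derivative C (x - y)) (at 0 within {0..1})"
    if C: "(F has_derivative C) (at y within \<Omega>)" for C
  proof -
    have "(F has_derivative C) (at (g 0) within g ` {0..1})"
      using has_derivative_subset[OF C sub] by (simp add: g_def)
    from has_derivative_in_compose[OF g this]
    have "((\<lambda>t. F (g t)) has_derivative (\<lambda>t. C (t *\<^sub>R (x - y)))) (at 0 within {0..1})" .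
    moreover have "linear C"
      using C by (rule has_derivative_linear)
    ultimately show ?thesis
      by (simp add: has_vector_derivative_def linear_scale)
  qed
  have "at (0::real) within {0..1} \<noteq> bot"
    by (simp add: trivial_limit_within islimpt_Icc)
  then show ?thesis
    by (rule vector_derivative_unique_within[OF _ vec[OF assms(4)] vec[OF assms(5)]])
qed

lemma bregman_eq:
  assumes "convex \<Omega>" "x \<in> \<Omega>" "y \<in> \<Omega>" "(F has_derivative A) (at y within \<Omega>)"
  shows "bregman \<Omega> F x y = F x - F y - A (x - y)"
proof -
  have "(F has_derivative frechet_derivative F (at y within \<Omega>)) (at y within \<Omega>)"
    using assms(4) differentiable_def frechet_derivative_works by blast
  then show ?thesis
    using has_derivative_within_convex_unique[OF assms(1-3) _ assms(4)] by (simp add: bregman_def)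
qed

lemma bregman_eq_at:
  assumes "convex \<Omega>" "x \<in> \<Omega>" "y \<in> \<Omega>" "F differentiable (at y)"
  shows "bregman \<Omega> F x y = F x - F y - frechet_derivative F (at y) (x - y)"
proof (rule bregman_eq[OF assms(1-3)])
  show "(F has_derivative frechet_derivative F (at y)) (at y within \<Omega>)"
    using assms(4) by (simp add: frechet_derivative_works has_derivative_at_withinI)
qed

lemma strictly_cone_convex_on_pos_comb:
  assumes K: "proper_cone K"
    and F: "strictly_cone_convex_on K \<Omega> F" and G: "strictly_cone_convex_on K \<Omega> G"
    and c: "c1 > 0" "c2 > (0::real)"
  shows "strictly_cone_convex_on K \<Omega> (\<lambda>x. c1 *\<^sub>R F x + c2 *\<^sub>R G x)"
proof -
  have scale: "c *\<^sub>R a \<in> interior K" if "a \<in> interior K" "c > 0" for a and c :: real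
  proof -
    have "open ((\<lambda>x. c *\<^sub>R x) ` interior K)"
      using that by (intro open_scaling) auto
    moreover have "(\<lambda>x. c *\<^sub>R x) ` interior K \<subseteq> K"
      using K that interior_subset[of K] by (auto simp: proper_cone_def cone_def)
    ultimately show ?thesis
      using that by (meson imageI interior_maximal subsetD)
  qed
  have add: "a + b \<in> interior K" if "a \<in> interior K" "b \<in> interior K" for a b
  proof -
    have "a + x \<in> K" if "x \<in> interior K" for x
      using K that \<open>a \<in> interior K\<close> interior_subset[of K]
      by (meson convex_cone proper_cone_def subsetD)
    then have "(\<lambda>x. a + x) ` interior K \<subseteq> K"
      by auto
    then show ?thesis
      using that by (meson imageI interior_maximal open_interior open_translation subsetD)
  qed
  show ?thesis
    unfolding strictly_cone_convex_on_def
  proof (intro conjI ballI impI)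
    show "convex \<Omega>"
      using F by (simp add: strictly_cone_convex_on_def)
    fix x y and \<theta> :: real
    assume *: "x \<in> \<Omega>" "y \<in> \<Omega>" "\<theta> \<in> {0<..<1}" "x \<noteq> y"
    let ?z = "\<theta> *\<^sub>R x + (1 - \<theta>) *\<^sub>R y"
    have "c1 *\<^sub>R (\<theta> *\<^sub>R F x + (1 - \<theta>) *\<^sub>R F y - F ?z)
        + c2 *\<^sub>R (\<theta> *\<^sub>R G x + (1 - \<theta>) *\<^sub>R G y - G ?z) \<in> interior K"
      using F G * c by (intro add scale) (auto simp: strictly_cone_convex_on_def cone_less_def)
    then show "c1 *\<^sub>R F ?z + c2 *\<^sub>R G ?z \<prec>\<^bsub>K\<^esub>
        \<theta> *\<^sub>R (c1 *\<^sub>R F x + c2 *\<^sub>R G x) + (1 - \<theta>) *\<^sub>R (c1 *\<^sub>R F y + c2 *\<^sub>R G y)"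
      by (simp add: cone_less_def algebra_simps)
  qed
qed

end

theory Submission
  imports Defs
begin

text \<open>
  Nonnegativity: convexity along the segment from \<open>y\<close> to \<open>x\<close> says that \<open>F x - F y\<close> dominates every
  difference quotient \<open>(F (y + t (x - y)) - F y) / t\<close> with \<open>0 < t \<le> 1\<close>, and closedness of \<open>K\<close>
  preserves this in the limit \<open>t \<rightarrow> 0\<close>. Convexity in the first argument: \<open>D\<^sub>F(\<cdot>, y)\<close> differs from
  \<open>F\<close> by an affine map.
\<close>

text \<open>The predicate \<open>cone\<close> also admits the empty set; the non-empty interior
  supplies a point, and scaling it by 0 gives the origin.\<close>

lemma proper_cone_zero: "proper_cone K \<Longrightarrow> 0 \<in> K"
  by (auto simp: proper_cone_def simp flip: cone_contains_0)

lemma proper_cone_scaleR: "proper_cone K \<Longrightarrow> a \<in> K \<Longrightarrow> 0 \<le> c \<Longrightarrow> c *\<^sub>R a \<in> K"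
  by (simp add: proper_cone_def cone_def)

text \<open>Lets the limit argument and the affine argument work with the weak inequality, which
  also covers coinciding points and the endpoints of the segment.\<close>

lemma strictly_cone_convex_on_imp_cone_convex_on:
  assumes K: "proper_cone K" and F: "strictly_cone_convex_on K \<Omega> F"
  shows "cone_convex_on K \<Omega> F"
  unfolding cone_convex_on_def
proof (intro conjI ballI)
  show "convex \<Omega>"
    using F by (simp add: strictly_cone_convex_on_def)
  fix x y and \<theta> :: real
  assume *: "x \<in> \<Omega>" "y \<in> \<Omega>" "\<theta> \<in> {0..1}"
  show "F (\<theta> *\<^sub>R x + (1 - \<theta>) *\<^sub>R y) \<preceq>\<^bsub>K\<^esub> \<theta> *\<^sub>R F x + (1 - \<theta>) *\<^sub>R F y"
  \<comment> \<open>In the cases on which strict convexity is silent, both sides coincide and their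
    difference is 0.\<close>
  proof (cases "x = y \<or> \<theta> = 0 \<or> \<theta> = 1")
    case True
    then show ?thesis
      using proper_cone_zero[OF K] by (auto simp: cone_le_def simp flip: scaleR_add_left)
  next
    case False
    then have "\<theta> \<in> {0<..<1}"
      using * by auto
    then have "F (\<theta> *\<^sub>R x + (1 - \<theta>) *\<^sub>R y) \<prec>\<^bsub>K\<^esub> \<theta> *\<^sub>R F x + (1 - \<theta>) *\<^sub>R F y"
      using F * False unfolding strictly_cone_convex_on_def by blast
    then show ?thesis
      unfolding cone_less_def cone_le_def by (rule subsetD[OF interior_subset])
  qed
qed

lemma bregman_nonneg:
  assumes K: "proper_cone K" and F: "cone_convex_on K \<Omega> F"
    and diff: "F differentiable_on \<Omega>" and x: "x \<in> \<Omega>" and y: "y \<in> \<Omega>"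
  shows "bregman \<Omega> F x y \<succeq>\<^bsub>K\<^esub> 0"
proof -
  define A where "A = frechet_derivative F (at y within \<Omega>)"
  define g where "g t = y + t *\<^sub>R (x - y)" for t :: real
  have conv: "convex \<Omega>"
    using F by (simp add: cone_convex_on_def)
  have g_eq: "g t = t *\<^sub>R x + (1 - t) *\<^sub>R y" for t
    by (simp add: g_def algebra_simps)
  \<comment> \<open>The derivative of \<open>F\<close> is taken within \<open>\<Omega>\<close>, so
    the chain rule applies along a path that stays in \<open>\<Omega>\<close>; at parameter 0 it
    yields a one-sided derivative.\<close>
  have sub: "g ` {0..1} \<subseteq> \<Omega>"
    using conv x y by (auto simp: g_eq intro!: convexD)
  have "(F has_derivative A) (at y within \<Omega>)"
    using diff y unfolding A_def differentiable_on_def by (simp add: frechet_derivative_works)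
  then have A: "linear A" "(F has_derivative A) (at (g 0) within g ` {0..1})"
    using has_derivative_subset[OF _ sub] by (auto simp: g_def has_derivative_linear)
  have "(g has_derivative (\<lambda>t. t *\<^sub>R (x - y))) (at 0 within {0..1})"
    unfolding g_def by (auto intro!: derivative_eq_intros)
  from has_derivative_in_compose[OF this A(2)]
  have "((\<lambda>t. F (g t)) has_vector_derivative A (x - y)) (at 0 within {0..1})"
    using A(1) by (simp add: has_vector_derivative_def linear_scale)
  then have "((\<lambda>t. (F (g t) - F y - t *\<^sub>R A (x - y)) /\<^sub>R \<bar>t\<bar>) \<longlongrightarrow> 0) (at 0 within {0..1})"
    by (simp add: has_vector_derivative_def has_derivative_at_within g_def)
  \<comment> \<open>On the punctured interval the norm of the increment is \<open>t\<close> itself,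
    so the normalized remainder is the difference quotient minus its limit.\<close>
  moreover have "\<forall>\<^sub>F t in at 0 within {0..1}. (F (g t) - F y - t *\<^sub>R A (x - y)) /\<^sub>R \<bar>t\<bar>
      = (F (g t) - F y) /\<^sub>R t - A (x - y)"
    by (simp add: eventually_at_filter scaleR_diff_right)
  ultimately have "((\<lambda>t. (F (g t) - F y) /\<^sub>R t - A (x - y)) \<longlongrightarrow> 0) (at 0 within {0..1})"
    by (rule Lim_transform_eventually)
  then have "((\<lambda>t. (F (g t) - F y) /\<^sub>R t) \<longlongrightarrow> A (x - y)) (at 0 within {0..1})"
    by (simp add: LIM_zero_iff)
  then have lim: "((\<lambda>t. F x - F y - (F (g t) - F y) /\<^sub>R t) \<longlongrightarrow> bregman \<Omega> F x y) (at 0 within {0..1})"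
    unfolding bregman_def A_def by (intro tendsto_intros)
  have "F x - F y - (F (g t) - F y) /\<^sub>R t \<in> K" if t: "t \<in> {0..1}" "t \<noteq> 0" for t
  proof -
    have "t *\<^sub>R F x + (1 - t) *\<^sub>R F y - F (g t) \<in> K"
      using F x y t unfolding cone_convex_on_def cone_le_def g_eq by blast
    \<comment> \<open>Dividing the convexity gap by \<open>t > 0\<close> stays in the cone and
      produces the expression whose limit is the divergence.\<close>
    then have "inverse t *\<^sub>R (t *\<^sub>R F x + (1 - t) *\<^sub>R F y - F (g t)) \<in> K"
      using K t by (intro proper_cone_scaleR) auto
    also have "inverse t *\<^sub>R (t *\<^sub>R F x + (1 - t) *\<^sub>R F y - F (g t)) = F x - F y - (F (g t) - F y) /\<^sub>R t"
      using t by (simp add: algebra_simps)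
    finally show ?thesis .
  qed
  then have "\<forall>\<^sub>F t in at 0 within {0..1}. F x - F y - (F (g t) - F y) /\<^sub>R t \<in> K"
    by (simp add: eventually_at_filter)
  \<comment> \<open>0 is a limit point of the interval, so the limit of values in the closed set
    \<open>K\<close> lies in \<open>K\<close>.\<close>
  moreover have "at (0::real) within {0..1} \<noteq> bot"
    by (simp add: trivial_limit_within)
  moreover have "closed K"
    using K by (simp add: proper_cone_def)
  ultimately have "bregman \<Omega> F x y \<in> K"
    using lim by (intro Lim_in_closed_set)
  then show ?thesis
    by (simp add: cone_le_def)
qed

lemma bregman_linear_comb:
  assumes "convex \<Omega>" "F differentiable_on \<Omega>" "G differentiable_on \<Omega>" "x \<in> \<Omega>" "y \<in> \<Omega>"
  shows "bregman \<Omega> (\<lambda>z. a *\<^sub>R F z + b *\<^sub>R G z) x y = a *\<^sub>R bregman \<Omega> F x y + b *\<^sub>R bregman \<Omega> G x y"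
proof -
  let ?A = "frechet_derivative F (at y within \<Omega>)" and ?B = "frechet_derivative G (at y within \<Omega>)"
  have "(F has_derivative ?A) (at y within \<Omega>)" "(G has_derivative ?B) (at y within \<Omega>)"
    using assms by (simp_all add: differentiable_on_def frechet_derivative_works[symmetric])
  then have "((\<lambda>z. a *\<^sub>R F z + b *\<^sub>R G z) has_derivative (\<lambda>h. a *\<^sub>R ?A h + b *\<^sub>R ?B h)) (at y within \<Omega>)"
    by (intro derivative_intros)
  \<comment> \<open>The derivative selected for the combination may differ from the combination of
    the selected derivatives; on the convex \<open>\<Omega>\<close> the two agree at
    \<open>x - y\<close>, which is all that the divergence sees.\<close>
  from bregman_eq[OF assms(1,4,5) this] show ?thesis
    by (simp add: bregman_def algebra_simps)
qed

lemma cone_convex_on_bregman: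
  assumes F: "cone_convex_on K \<Omega> F" and diff: "F differentiable (at y within \<Omega>)"
  shows "cone_convex_on K \<Omega> (\<lambda>x. bregman \<Omega> F x y)"
proof -
  let ?A = "frechet_derivative F (at y within \<Omega>)"
  have A: "linear ?A"
    using diff by (rule linear_frechet_derivative)
  \<comment> \<open>The weights sum to 1 and \<open>?A\<close> is linear, so the affine part cancels
    and the convexity gap of the divergence is exactly that of \<open>F\<close>.\<close>
  have "\<theta> *\<^sub>R bregman \<Omega> F u y + (1 - \<theta>) *\<^sub>R bregman \<Omega> F v y - bregman \<Omega> F (\<theta> *\<^sub>R u + (1 - \<theta>) *\<^sub>R v) y
      = \<theta> *\<^sub>R F u + (1 - \<theta>) *\<^sub>R F v - F (\<theta> *\<^sub>R u + (1 - \<theta>) *\<^sub>R v)" for u v and \<theta> :: real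
    by (simp add: bregman_def linear_diff[OF A] linear_add[OF A] linear_scale[OF A] algebra_simps)
  then show ?thesis
    using F by (simp add: cone_convex_on_def cone_le_def)
qed

theorem theorem2:
  fixes K :: "(real ^ 'n ^ 'm) set"
    and \<Omega> :: "'w::banach set"
    and F G :: "'w \<Rightarrow> real ^ 'n ^ 'm"
  assumes "proper_cone K"
    and "convex \<Omega>"
    and "F differentiable_on \<Omega>" and "strictly_cone_convex_on K \<Omega> F"
    and "G differentiable_on \<Omega>" and "strictly_cone_convex_on K \<Omega> G"
  shows "(\<forall>x\<in>\<Omega>. \<forall>y\<in>\<Omega>. bregman \<Omega> F x y \<succeq>\<^bsub>K\<^esub> 0)
    \<and> (\<forall>c1 c2 :: real. c1 > 0 \<longrightarrow> c2 > 0 \<longrightarrow> (\<forall>x\<in>\<Omega>. \<forall>y\<in>\<Omega>.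
          bregman \<Omega> (\<lambda>z. c1 *\<^sub>R F z + c2 *\<^sub>R G z) x y
            = c1 *\<^sub>R bregman \<Omega> F x y + c2 *\<^sub>R bregman \<Omega> G x y))
    \<and> (\<forall>y\<in>\<Omega>. cone_convex_on K \<Omega> (\<lambda>x. bregman \<Omega> F x y))"
proof (intro conjI ballI allI impI)
  have F: "cone_convex_on K \<Omega> F"
    using assms by (intro strictly_cone_convex_on_imp_cone_convex_on)
  fix x y
  assume x: "x \<in> \<Omega>" and y: "y \<in> \<Omega>"
  show "bregman \<Omega> F x y \<succeq>\<^bsub>K\<^esub> 0"
    using assms(1) F assms(3) x y by (rule bregman_nonneg)
  show "bregman \<Omega> (\<lambda>z. c1 *\<^sub>R F z + c2 *\<^sub>R G z) x y
      = c1 *\<^sub>R bregman \<Omega> F x y + c2 *\<^sub>R bregman \<Omega> G x y" for c1 c2 :: real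
    using assms(2,3,5) x y by (rule bregman_linear_comb)
next
  fix y
  assume "y \<in> \<Omega>"
  then show "cone_convex_on K \<Omega> (\<lambda>x. bregman \<Omega> F x y)"
    using assms
    by (intro cone_convex_on_bregman strictly_cone_convex_on_imp_cone_convex_on)
      (auto simp: differentiable_on_def)
qed

end
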